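(* There exist a $C^*$-algebra $\mathcal{A}$, a Hilbert $C^*$-module $\mathcal{N}$ over $\mathcal{A}$ and a bounded $\mathcal{A}$-linear operator $F:\mathcal{N}\to\mathcal{N}$ such that, with $B$ denoting the unit ball of $\mathcal{N}$, for every $\varepsilon>0$ there exist elements $z_1,\dots,z_s\in\mathcal{N}$ such that for every $x\in F(B)$ there exist $a_1,\dots,a_s\in\mathcal{A}$ with $$\Bigl\|x-\sum_{k=1}^sz_ka_k\Bigr\|<\varepsilon,$$ but $F(B)$ is not $\mathcal{A}$-precompact, and, hence, $F$ is not Banach-compact.
   Context: Hilbert $C^*$-modules are right Hilbert modules. A bounded subset $Z\subset\mathcal{N}$ is $\mathcal{A}$-precompact if for every $\varepsilon>0$ there exist $M_\varepsilon>0$ and $z_1,\dots,z_s\in\mathcal{N}$ such that for every $x\in Z$ there exist $a_1,\dots,a_s\in\mathcal{A}$ with $\|a_k\|\le M_\varepsilon$ and $\|x-\sum_{k=1}^sz_ka_k\|<\varepsilon$. An operator $\mathcal{N}\to\mathcal{N}$ is Banach-compact if it lies in the operator-norm closure of the linear span of the operators $\theta_{x,f}(z)=x\,f(z)$, where $x\in\mathcal{N}$ and $f:\mathcal{N}\to\mathcal{A}$ is a bounded $\mathcal{A}$-linear functional. *)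

theory Defs
  imports Complex_Main "HOL-Algebra.Module"
begin

definition complex_ring :: "complex ring" where
  "complex_ring = \<lparr>carrier = UNIV, mult = (*), one = 1, zero = 0, add = (+)\<rparr>"

(* A C*-algebra need not be unital: no axiom below mentions the field "one" inherited
   from the ring record.  In Hilbert modules the inherited fields "mult" and "one" are
   unused, as for every module record of HOL-Algebra. *)

record 'a cstar = "(complex, 'a) module" +
  star :: "'a \<Rightarrow> 'a"
  cnorm :: "'a \<Rightarrow> real"

record ('a, 'n) hmodule = "(complex, 'n) module" +
  act :: "'n \<Rightarrow> 'a \<Rightarrow> 'n"  (infixl \<open>\<cdot>\<index>\<close> 70)
  ip :: "'n \<Rightarrow> 'n \<Rightarrow> 'a"

definition cauchy_complete :: "('v, 'm) ring_scheme \<Rightarrow> ('v \<Rightarrow> real) \<Rightarrow> bool" where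
  "cauchy_complete V nrm \<longleftrightarrow>
    (\<forall>\<sigma> :: nat \<Rightarrow> 'v.
      range \<sigma> \<subseteq> carrier V \<and>
      (\<forall>e>0. \<exists>K. \<forall>m\<ge>K. \<forall>n\<ge>K. nrm (\<sigma> m \<ominus>\<^bsub>V\<^esub> \<sigma> n) < e) \<longrightarrow>
      (\<exists>l\<in>carrier V. (\<lambda>n. nrm (\<sigma> n \<ominus>\<^bsub>V\<^esub> l)) \<longlonglongrightarrow> 0))"

locale cstar_algebra =
  fixes A :: "'a cstar"  (structure)
  assumes complex_vector_space: "module complex_ring A"
    and mult_closed: "\<lbrakk>a \<in> carrier A; b \<in> carrier A\<rbrakk> \<Longrightarrow> a \<otimes> b \<in> carrier A"
    and mult_assoc: "\<lbrakk>a \<in> carrier A; b \<in> carrier A; c \<in> carrier A\<rbrakk>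
      \<Longrightarrow> (a \<otimes> b) \<otimes> c = a \<otimes> (b \<otimes> c)"
    and mult_l_distr: "\<lbrakk>a \<in> carrier A; b \<in> carrier A; c \<in> carrier A\<rbrakk>
      \<Longrightarrow> (a \<oplus> b) \<otimes> c = a \<otimes> c \<oplus> b \<otimes> c"
    and mult_r_distr: "\<lbrakk>a \<in> carrier A; b \<in> carrier A; c \<in> carrier A\<rbrakk>
      \<Longrightarrow> a \<otimes> (b \<oplus> c) = a \<otimes> b \<oplus> a \<otimes> c"
    and mult_smult_l: "\<lbrakk>a \<in> carrier A; b \<in> carrier A\<rbrakk> \<Longrightarrow> (\<mu> \<odot> a) \<otimes> b = \<mu> \<odot> (a \<otimes> b)"
    and mult_smult_r: "\<lbrakk>a \<in> carrier A; b \<in> carrier A\<rbrakk> \<Longrightarrow> a \<otimes> (\<mu> \<odot> b) = \<mu> \<odot> (a \<otimes> b)"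
    and star_closed: "a \<in> carrier A \<Longrightarrow> star A a \<in> carrier A"
    and star_star: "a \<in> carrier A \<Longrightarrow> star A (star A a) = a"
    and star_add: "\<lbrakk>a \<in> carrier A; b \<in> carrier A\<rbrakk> \<Longrightarrow> star A (a \<oplus> b) = star A a \<oplus> star A b"
    and star_smult: "a \<in> carrier A \<Longrightarrow> star A (\<mu> \<odot> a) = cnj \<mu> \<odot> star A a"
    and star_mult: "\<lbrakk>a \<in> carrier A; b \<in> carrier A\<rbrakk> \<Longrightarrow> star A (a \<otimes> b) = star A b \<otimes> star A a"
    and cnorm_nonneg: "a \<in> carrier A \<Longrightarrow> 0 \<le> cnorm A a"
    and cnorm_eq_0: "a \<in> carrier A \<Longrightarrow> cnorm A a = 0 \<longleftrightarrow> a = \<zero>"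
    and cnorm_smult: "a \<in> carrier A \<Longrightarrow> cnorm A (\<mu> \<odot> a) = cmod \<mu> * cnorm A a"
    and cnorm_triangle: "\<lbrakk>a \<in> carrier A; b \<in> carrier A\<rbrakk>
      \<Longrightarrow> cnorm A (a \<oplus> b) \<le> cnorm A a + cnorm A b"
    and cnorm_mult: "\<lbrakk>a \<in> carrier A; b \<in> carrier A\<rbrakk>
      \<Longrightarrow> cnorm A (a \<otimes> b) \<le> cnorm A a * cnorm A b"
    and cstar_identity: "a \<in> carrier A \<Longrightarrow> cnorm A (star A a \<otimes> a) = (cnorm A a)\<^sup>2"
    and complete: "cauchy_complete A (cnorm A)"

definition positive :: "'a cstar \<Rightarrow> 'a \<Rightarrow> bool" where
  "positive A a \<longleftrightarrow> (\<exists>b\<in>carrier A. a = star A b \<otimes>\<^bsub>A\<^esub> b)"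

definition hnorm :: "'a cstar \<Rightarrow> ('a, 'n) hmodule \<Rightarrow> 'n \<Rightarrow> real" where
  "hnorm A N x = sqrt (cnorm A (ip N x x))"

(* The triangle inequality for hnorm is not an axiom: it follows from the
   Cauchy-Schwarz inequality for the A-valued inner product. *)

locale hilbert_module = cstar_algebra A
  for A :: "'a cstar"  (structure) and N :: "('a, 'n) hmodule" +
  assumes module_complex_vector_space: "module complex_ring N"
    and act_closed: "\<lbrakk>x \<in> carrier N; a \<in> carrier A\<rbrakk> \<Longrightarrow> x \<cdot>\<^bsub>N\<^esub> a \<in> carrier N"
    and act_l_distr: "\<lbrakk>x \<in> carrier N; y \<in> carrier N; a \<in> carrier A\<rbrakk>
      \<Longrightarrow> (x \<oplus>\<^bsub>N\<^esub> y) \<cdot>\<^bsub>N\<^esub> a = x \<cdot>\<^bsub>N\<^esub> a \<oplus>\<^bsub>N\<^esub> y \<cdot>\<^bsub>N\<^esub> a"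
    and act_r_distr: "\<lbrakk>x \<in> carrier N; a \<in> carrier A; b \<in> carrier A\<rbrakk>
      \<Longrightarrow> x \<cdot>\<^bsub>N\<^esub> (a \<oplus> b) = x \<cdot>\<^bsub>N\<^esub> a \<oplus>\<^bsub>N\<^esub> x \<cdot>\<^bsub>N\<^esub> b"
    and act_mult: "\<lbrakk>x \<in> carrier N; a \<in> carrier A; b \<in> carrier A\<rbrakk>
      \<Longrightarrow> x \<cdot>\<^bsub>N\<^esub> (a \<otimes> b) = (x \<cdot>\<^bsub>N\<^esub> a) \<cdot>\<^bsub>N\<^esub> b"
    and act_smult_l: "\<lbrakk>x \<in> carrier N; a \<in> carrier A\<rbrakk>
      \<Longrightarrow> (\<mu> \<odot>\<^bsub>N\<^esub> x) \<cdot>\<^bsub>N\<^esub> a = \<mu> \<odot>\<^bsub>N\<^esub> (x \<cdot>\<^bsub>N\<^esub> a)"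
    and act_smult_r: "\<lbrakk>x \<in> carrier N; a \<in> carrier A\<rbrakk>
      \<Longrightarrow> x \<cdot>\<^bsub>N\<^esub> (\<mu> \<odot> a) = \<mu> \<odot>\<^bsub>N\<^esub> (x \<cdot>\<^bsub>N\<^esub> a)"
    and ip_closed: "\<lbrakk>x \<in> carrier N; y \<in> carrier N\<rbrakk> \<Longrightarrow> ip N x y \<in> carrier A"
    and ip_add: "\<lbrakk>x \<in> carrier N; y \<in> carrier N; z \<in> carrier N\<rbrakk>
      \<Longrightarrow> ip N x (y \<oplus>\<^bsub>N\<^esub> z) = ip N x y \<oplus> ip N x z"
    and ip_smult: "\<lbrakk>x \<in> carrier N; y \<in> carrier N\<rbrakk> \<Longrightarrow> ip N x (\<mu> \<odot>\<^bsub>N\<^esub> y) = \<mu> \<odot> ip N x y"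
    and ip_act: "\<lbrakk>x \<in> carrier N; y \<in> carrier N; a \<in> carrier A\<rbrakk>
      \<Longrightarrow> ip N x (y \<cdot>\<^bsub>N\<^esub> a) = ip N x y \<otimes> a"
    and ip_star: "\<lbrakk>x \<in> carrier N; y \<in> carrier N\<rbrakk> \<Longrightarrow> star A (ip N x y) = ip N y x"
    and ip_positive: "x \<in> carrier N \<Longrightarrow> positive A (ip N x x)"
    and ip_definite: "\<lbrakk>x \<in> carrier N; ip N x x = \<zero>\<rbrakk> \<Longrightarrow> x = \<zero>\<^bsub>N\<^esub>"
    and hilbert_complete: "cauchy_complete N (hnorm A N)"

definition unit_ball :: "'a cstar \<Rightarrow> ('a, 'n) hmodule \<Rightarrow> 'n set" where
  "unit_ball A N = {x \<in> carrier N. hnorm A N x \<le> 1}"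

(* Operators and functionals are total functions on the underlying type; only their
   values on the carrier matter. *)

definition bounded_operator :: "'a cstar \<Rightarrow> ('a, 'n) hmodule \<Rightarrow> ('n \<Rightarrow> 'n) \<Rightarrow> bool" where
  "bounded_operator A N F \<longleftrightarrow>
    (\<forall>x\<in>carrier N. F x \<in> carrier N) \<and>
    (\<forall>x\<in>carrier N. \<forall>y\<in>carrier N. F (x \<oplus>\<^bsub>N\<^esub> y) = F x \<oplus>\<^bsub>N\<^esub> F y) \<and>
    (\<forall>\<mu>. \<forall>x\<in>carrier N. F (\<mu> \<odot>\<^bsub>N\<^esub> x) = \<mu> \<odot>\<^bsub>N\<^esub> F x) \<and>
    (\<forall>x\<in>carrier N. \<forall>a\<in>carrier A. F (x \<cdot>\<^bsub>N\<^esub> a) = F x \<cdot>\<^bsub>N\<^esub> a) \<and>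
    (\<exists>C. \<forall>x\<in>carrier N. hnorm A N (F x) \<le> C * hnorm A N x)"

definition bounded_functional :: "'a cstar \<Rightarrow> ('a, 'n) hmodule \<Rightarrow> ('n \<Rightarrow> 'a) \<Rightarrow> bool" where
  "bounded_functional A N f \<longleftrightarrow>
    (\<forall>x\<in>carrier N. f x \<in> carrier A) \<and>
    (\<forall>x\<in>carrier N. \<forall>y\<in>carrier N. f (x \<oplus>\<^bsub>N\<^esub> y) = f x \<oplus>\<^bsub>A\<^esub> f y) \<and>
    (\<forall>\<mu>. \<forall>x\<in>carrier N. f (\<mu> \<odot>\<^bsub>N\<^esub> x) = \<mu> \<odot>\<^bsub>A\<^esub> f x) \<and>
    (\<forall>x\<in>carrier N. \<forall>a\<in>carrier A. f (x \<cdot>\<^bsub>N\<^esub> a) = f x \<otimes>\<^bsub>A\<^esub> a) \<and>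
    (\<exists>C. \<forall>x\<in>carrier N. cnorm A (f x) \<le> C * hnorm A N x)"

definition A_precompact :: "'a cstar \<Rightarrow> ('a, 'n) hmodule \<Rightarrow> 'n set \<Rightarrow> bool" where
  "A_precompact A N Z \<longleftrightarrow>
    Z \<subseteq> carrier N \<and> (\<exists>C. \<forall>x\<in>Z. hnorm A N x \<le> C) \<and>
    (\<forall>\<epsilon>>0. \<exists>M>0. \<exists>(s::nat) z. (\<forall>k\<in>{1..s}. z k \<in> carrier N) \<and>
      (\<forall>x\<in>Z. \<exists>a. (\<forall>k\<in>{1..s}. a k \<in> carrier A \<and> cnorm A (a k) \<le> M) \<and>
        hnorm A N (x \<ominus>\<^bsub>N\<^esub> (\<Oplus>\<^bsub>N\<^esub>k\<in>{1..s}. z k \<cdot>\<^bsub>N\<^esub> a k)) < \<epsilon>))"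

(* Meaningful only for bounded operators, on which the supremum is over a bounded set. *)
definition op_norm :: "'a cstar \<Rightarrow> ('a, 'n) hmodule \<Rightarrow> ('n \<Rightarrow> 'n) \<Rightarrow> real" where
  "op_norm A N T = (SUP x\<in>unit_ball A N. hnorm A N (T x))"

definition theta :: "('a, 'n) hmodule \<Rightarrow> 'n \<Rightarrow> ('n \<Rightarrow> 'a) \<Rightarrow> 'n \<Rightarrow> 'n" where
  "theta N x f z = x \<cdot>\<^bsub>N\<^esub> f z"

definition theta_span :: "'a cstar \<Rightarrow> ('a, 'n) hmodule \<Rightarrow> ('n \<Rightarrow> 'n) set" where
  "theta_span A N =
    {(\<lambda>z. \<Oplus>\<^bsub>N\<^esub>k\<in>{1..n}. c k \<odot>\<^bsub>N\<^esub> theta N (x k) (f k) z) | (n::nat) c x f.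
      \<forall>k\<in>{1..n}. x k \<in> carrier N \<and> bounded_functional A N (f k)}"

definition Banach_compact :: "'a cstar \<Rightarrow> ('a, 'n) hmodule \<Rightarrow> ('n \<Rightarrow> 'n) \<Rightarrow> bool" where
  "Banach_compact A N F \<longleftrightarrow>
    bounded_operator A N F \<and>
    (\<forall>\<epsilon>>0. \<exists>T\<in>theta_span A N. op_norm A N (\<lambda>z. F z \<ominus>\<^bsub>N\<^esub> T z) < \<epsilon>)"

end

theory Submission
  imports Defs
begin

text \<open>
  Take for \<open>\<A>\<close> the C*-algebra \<open>c\<^sub>0\<close> of complex null sequences with the sup norm, regard
  it as a Hilbert module \<open>\<N>\<close> over itself, and let \<open>F\<close> be the identity, so that \<open>F(B)\<close> is the
  unit ball of \<open>c\<^sub>0\<close>. What drives the example is that \<open>c\<^sub>0\<close> has no unit but is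
  topologically generated by a single element.

  Without a bound on the coefficients one generator is enough for every \<open>\<epsilon>\<close>. Let \<open>z\<close> be
  the null sequence \<open>1 / (n + 1)\<close>. As no entry of \<open>z\<close> vanishes, every finitely supported
  sequence is of the form \<open>z a\<close>, and these sequences are dense (\<open>ideal_dense_c0\<close>). The
  entries \<open>(n + 1) x(n)\<close> of the coefficient \<open>a\<close> needed for \<open>x\<close> are not bounded uniformly over
  the unit ball, and no choice of finitely many generators can repair this: if
  \<open>\<parallel>a\<^sub>k\<parallel> \<le> M\<close>, then the \<open>n\<close>-th entry of \<open>\<Sum>\<^sub>k z\<^sub>k a\<^sub>k\<close> has modulus at most
  \<open>M \<Sum>\<^sub>k \<bar>z\<^sub>k(n)\<bar>\<close>. For fixed \<open>z\<^sub>1, \<dots>, z\<^sub>s\<close> this tends to \<open>0\<close> as \<open>n\<close> grows, whereas the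
  unit ball contains sequences with \<open>n\<close>-th entry \<open>1\<close>. Hence the unit ball is not precompact
  (\<open>not_A_precompact_unit_ball_c0\<close>).

  That the identity is not Banach-compact follows from the general principle that a
  Banach-compact operator maps the unit ball to a precompact set
  (\<open>Banach_compact_imp_A_precompact\<close>): if \<open>T = \<Sum>\<^sub>k c\<^sub>k \<theta>(x\<^sub>k, f\<^sub>k)\<close> approximates \<open>F\<close>, then
  \<open>T v = \<Sum>\<^sub>k x\<^sub>k (c\<^sub>k f\<^sub>k(v))\<close>, and boundedness of the functionals \<open>f\<^sub>k\<close> bounds the
  coefficients uniformly over the unit ball.
\<close>

section \<open>C*-algebras as Hilbert modules over themselves\<close>

context cstar_algebra
begin

text \<open>
  The C*-identity gives \<open>\<parallel>b\<parallel>\<^sup>2 \<le> \<parallel>b\<^sup>*\<parallel> \<parallel>b\<parallel>\<close>; cancelling \<open>\<parallel>b\<parallel>\<close> and applying the result to \<open>b\<close>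
  and to \<open>b\<^sup>*\<close> yields both inequalities.
\<close>

lemma cnorm_star:
  assumes a: "a \<in> carrier A"
  shows "cnorm A (star A a) = cnorm A a"
proof -
  have le: "cnorm A b \<le> cnorm A (star A b)" if b: "b \<in> carrier A" for b
  proof (cases "cnorm A b = 0")
    case True
    then show ?thesis using cnorm_nonneg[OF star_closed[OF b]] by simp
  next
    case False
    have "cnorm A b * cnorm A b \<le> cnorm A (star A b) * cnorm A b"
      using cnorm_mult[OF star_closed[OF b] b] cstar_identity[OF b]
      by (simp add: power2_eq_square)
    with False cnorm_nonneg[OF b] show ?thesis by simp
  qed
  show ?thesis
    using le[OF a] le[OF star_closed[OF a]] star_star[OF a] by simp
qed

end

definition self_module :: "'a cstar \<Rightarrow> ('a, 'a) hmodule" where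
  "self_module A =
    \<lparr>carrier = carrier A, mult = mult A, one = one A, zero = zero A, add = add A,
     smult = smult A, act = mult A, ip = (\<lambda>a b. star A a \<otimes>\<^bsub>A\<^esub> b)\<rparr>"

lemma self_module_simps [simp]:
  "carrier (self_module A) = carrier A"
  "zero (self_module A) = zero A"
  "add (self_module A) = add A"
  "smult (self_module A) = smult A"
  "act (self_module A) = mult A"
  "ip (self_module A) a b = star A a \<otimes>\<^bsub>A\<^esub> b"
  by (simp_all add: self_module_def)

context cstar_algebra
begin

lemma module_self_module: "module complex_ring (self_module A)"
proof -
  interpret m: module complex_ring A by (rule complex_vector_space)
  show ?thesis
  proof (rule moduleI)
    show "cring complex_ring" by (rule m.R.is_cring)
    show "abelian_group (self_module A)"
    proof (rule abelian_groupI)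
      fix x assume "x \<in> carrier (self_module A)"
      then show "\<exists>y\<in>carrier (self_module A). y \<oplus>\<^bsub>self_module A\<^esub> x = \<zero>\<^bsub>self_module A\<^esub>"
        using m.M.l_neg by (auto intro!: bexI[of _ "\<ominus> x"])
    qed (auto simp: m.M.a_ac)
  qed (auto simp: m.smult_l_distr m.smult_r_distr m.smult_assoc1)
qed

lemma minus_self_module:
  assumes "x \<in> carrier A" "y \<in> carrier A"
  shows "x \<ominus>\<^bsub>self_module A\<^esub> y = x \<ominus> y"
proof -
  interpret m: module complex_ring A by (rule complex_vector_space)
  interpret n: module complex_ring "self_module A" by (rule module_self_module)
  have "\<ominus>\<^bsub>self_module A\<^esub> y = \<ominus> y"
    by (rule n.M.minus_equality) (use assms m.M.l_neg in auto)
  then show ?thesis by (simp add: a_minus_def)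
qed

lemma hnorm_self_module: "a \<in> carrier A \<Longrightarrow> hnorm A (self_module A) a = cnorm A a"
  by (simp add: hnorm_def cstar_identity cnorm_nonneg)

text \<open>
  By the C*-identity the module norm is the norm of the algebra. So completeness of the
  module is completeness of the algebra, and definiteness of the inner product is
  definiteness of the norm.
\<close>

lemma hilbert_module_self_module: "hilbert_module A (self_module A)"
proof (intro hilbert_module.intro hilbert_module_axioms.intro)
  show "cstar_algebra A" by (rule cstar_algebra_axioms)
  show "module complex_ring (self_module A)" by (rule module_self_module)
  show "cauchy_complete (self_module A) (hnorm A (self_module A))"
  proof -
    interpret m: module complex_ring A by (rule complex_vector_space)
    have eq: "hnorm A (self_module A) (x \<ominus>\<^bsub>self_module A\<^esub> y) = cnorm A (x \<ominus> y)"
      if "x \<in> carrier A" "y \<in> carrier A" for x y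
      using that by (simp add: minus_self_module hnorm_self_module)
    show ?thesis
      unfolding cauchy_complete_def
    proof (intro allI impI, elim conjE)
      fix \<sigma> :: "nat \<Rightarrow> 'a"
      assume ran: "range \<sigma> \<subseteq> carrier (self_module A)"
        and cau: "\<forall>e>0. \<exists>K. \<forall>m\<ge>K. \<forall>n\<ge>K.
          hnorm A (self_module A) (\<sigma> m \<ominus>\<^bsub>self_module A\<^esub> \<sigma> n) < e"
      from ran have \<sigma>: "\<sigma> n \<in> carrier A" for n by auto
      from cau have "\<forall>e>0. \<exists>K. \<forall>m\<ge>K. \<forall>n\<ge>K. cnorm A (\<sigma> m \<ominus> \<sigma> n) < e"
        by (simp add: eq \<sigma>)
      then obtain l where "l \<in> carrier A" "(\<lambda>n. cnorm A (\<sigma> n \<ominus> l)) \<longlonglongrightarrow> 0"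
        using complete \<sigma> unfolding cauchy_complete_def by (metis image_subsetI)
      then show "\<exists>l\<in>carrier (self_module A).
          (\<lambda>n. hnorm A (self_module A) (\<sigma> n \<ominus>\<^bsub>self_module A\<^esub> l)) \<longlonglongrightarrow> 0"
        by (auto simp: eq \<sigma>)
    qed
  qed
next
  fix x assume x: "x \<in> carrier (self_module A)"
    and z: "ip (self_module A) x x = \<zero>"
  interpret m: module complex_ring A by (rule complex_vector_space)
  have "cnorm A (star A x \<otimes> x) = 0"
    using z cnorm_eq_0[of "\<zero>"] by simp
  then show "x = \<zero>\<^bsub>self_module A\<^esub>"
    using x cstar_identity[of x] cnorm_eq_0[of x] by simp
next
  fix x assume "x \<in> carrier (self_module A)"
  then show "positive A (ip (self_module A) x x)"
    by (auto simp: positive_def)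
qed (auto simp: mult_closed mult_l_distr mult_r_distr mult_assoc mult_smult_l mult_smult_r
      star_closed star_mult star_star)

end

section \<open>Banach-compact operators map the unit ball to a precompact set\<close>

context hilbert_module
begin

lemma hnorm_nonneg: "x \<in> carrier N \<Longrightarrow> 0 \<le> hnorm A N x"
  by (simp add: hnorm_def cnorm_nonneg ip_closed)

text \<open>
  The inner product of \<open>x a\<close> with itself is \<open>a\<^sup>* \<langle>x, x\<rangle> a\<close>, so submultiplicativity and
  \<open>\<parallel>a\<^sup>*\<parallel> = \<parallel>a\<parallel>\<close> suffice.
\<close>

lemma hnorm_act_le:
  assumes x: "x \<in> carrier N" and a: "a \<in> carrier A"
  shows "hnorm A N (x \<cdot>\<^bsub>N\<^esub> a) \<le> hnorm A N x * cnorm A a"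
proof -
  have xa: "x \<cdot>\<^bsub>N\<^esub> a \<in> carrier N" by (rule act_closed[OF x a])
  have "ip N (x \<cdot>\<^bsub>N\<^esub> a) x = star A (ip N x (x \<cdot>\<^bsub>N\<^esub> a))"
    by (simp add: ip_star x xa)
  also have "\<dots> = star A a \<otimes> ip N x x"
    by (simp add: ip_act x a star_mult ip_closed ip_star)
  finally have "ip N (x \<cdot>\<^bsub>N\<^esub> a) (x \<cdot>\<^bsub>N\<^esub> a) = star A a \<otimes> ip N x x \<otimes> a"
    by (simp add: ip_act[OF xa x a])
  then have "cnorm A (ip N (x \<cdot>\<^bsub>N\<^esub> a) (x \<cdot>\<^bsub>N\<^esub> a))
      \<le> cnorm A (star A a \<otimes> ip N x x) * cnorm A a"
    by (simp add: cnorm_mult mult_closed star_closed ip_closed x a)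
  also have "\<dots> \<le> (cnorm A (star A a) * cnorm A (ip N x x)) * cnorm A a"
    by (intro mult_right_mono cnorm_mult cnorm_nonneg star_closed ip_closed x a)
  also have "\<dots> = cnorm A (ip N x x) * (cnorm A a)\<^sup>2"
    by (simp add: cnorm_star a power2_eq_square)
  finally have "hnorm A N (x \<cdot>\<^bsub>N\<^esub> a) \<le> sqrt (cnorm A (ip N x x) * (cnorm A a)\<^sup>2)"
    unfolding hnorm_def by (rule real_sqrt_le_mono)
  then show ?thesis
    by (simp add: hnorm_def real_sqrt_mult cnorm_nonneg a)
qed

lemma hnorm_uminus:
  assumes y: "y \<in> carrier N"
  shows "hnorm A N (\<ominus>\<^bsub>N\<^esub> y) = hnorm A N y"
proof -
  interpret n: module complex_ring N by (rule module_complex_vector_space)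
  have my: "(-1) \<odot>\<^bsub>N\<^esub> y \<in> carrier N"
    using n.smult_closed[of "-1" y] y by (simp add: complex_ring_def)
  have "(-1) \<odot>\<^bsub>N\<^esub> y \<oplus>\<^bsub>N\<^esub> y = \<zero>\<^bsub>N\<^esub>"
    using n.smult_l_distr[of "-1" 1 y] n.smult_one[of y] n.smult_l_null[of y] y
    by (simp add: complex_ring_def)
  then have neg: "\<ominus>\<^bsub>N\<^esub> y = (-1) \<odot>\<^bsub>N\<^esub> y"
    using n.M.minus_equality my y by blast
  have "ip N ((-1) \<odot>\<^bsub>N\<^esub> y) y = star A (ip N y ((-1) \<odot>\<^bsub>N\<^esub> y))"
    by (simp add: ip_star y my)
  also have "\<dots> = (-1) \<odot> ip N y y"
    by (simp add: ip_smult y star_smult ip_closed ip_star)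
  finally have "cnorm A (ip N ((-1) \<odot>\<^bsub>N\<^esub> y) ((-1) \<odot>\<^bsub>N\<^esub> y)) = cnorm A (ip N y y)"
    using ip_smult[OF my y, of "-1"]
      cnorm_smult[OF ip_closed[OF my y], of "-1"] cnorm_smult[OF ip_closed[OF y y], of "-1"]
    by simp
  then show ?thesis by (simp add: hnorm_def neg)
qed

text \<open>
  The scalars of a finite-rank approximation \<open>T\<close> are absorbed into the coefficients
  \<open>a v k = c k \<odot> f k v\<close>, for which the bounds \<open>D k\<close> of the functionals give a uniform
  \<open>M\<close>. The estimate \<open>\<parallel>F v - T v\<parallel> < \<epsilon>\<close> on the unit ball is read off from the operator norm,
  which as a real supremum controls the values only once \<open>F - T\<close> is known to be
  bounded; this is where the triangle inequality enters. It is taken as a hypothesis because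
  its general proof, by the Cauchy-Schwarz inequality, needs the order structure of the
  algebra, while for a C*-algebra as a module over itself it is an axiom about the norm.
\<close>

lemma Banach_compact_imp_A_precompact:
  assumes tri: "\<And>x y. \<lbrakk>x \<in> carrier N; y \<in> carrier N\<rbrakk>
      \<Longrightarrow> hnorm A N (x \<oplus>\<^bsub>N\<^esub> y) \<le> hnorm A N x + hnorm A N y"
    and F: "Banach_compact A N F"
  shows "A_precompact A N (F ` unit_ball A N)"
proof -
  interpret n: module complex_ring N by (rule module_complex_vector_space)
  interpret m: module complex_ring A by (rule complex_vector_space)
  have Fcl: "\<And>x. x \<in> carrier N \<Longrightarrow> F x \<in> carrier N"
    using F by (auto simp: Banach_compact_def bounded_operator_def)
  obtain C where C: "\<And>x. x \<in> carrier N \<Longrightarrow> hnorm A N (F x) \<le> C * hnorm A N x"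
    using F unfolding Banach_compact_def bounded_operator_def by blast
  have FC: "hnorm A N (F x) \<le> \<bar>C\<bar>" if "x \<in> unit_ball A N" for x
  proof -
    have x: "x \<in> carrier N" "hnorm A N x \<le> 1" using that by (auto simp: unit_ball_def)
    have "C * hnorm A N x \<le> \<bar>C\<bar> * 1"
      by (rule mult_mono) (use x hnorm_nonneg in auto)
    with C[OF x(1)] show ?thesis by simp
  qed
  have hsum: "hnorm A N (\<Oplus>\<^bsub>N\<^esub>k\<in>S. g k) \<le> (\<Sum>k\<in>S. hnorm A N (g k))"
    if "finite S" "\<And>k. k \<in> S \<Longrightarrow> g k \<in> carrier N" for S :: "nat set" and g
    using that
  proof (induction S)
    case empty
    then show ?case
      using ip_smult[of "\<zero>\<^bsub>N\<^esub>" "\<zero>\<^bsub>N\<^esub>" 0] cnorm_smult[of "ip N \<zero>\<^bsub>N\<^esub> \<zero>\<^bsub>N\<^esub>" 0]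
        n.smult_r_null[of 0]
      by (simp add: hnorm_def ip_closed complex_ring_def)
  next
    case (insert k S)
    have "hnorm A N (\<Oplus>\<^bsub>N\<^esub>k\<in>insert k S. g k) = hnorm A N (g k \<oplus>\<^bsub>N\<^esub> (\<Oplus>\<^bsub>N\<^esub>k\<in>S. g k))"
      using insert by (subst n.M.finsum_insert) auto
    also have "\<dots> \<le> hnorm A N (g k) + hnorm A N (\<Oplus>\<^bsub>N\<^esub>k\<in>S. g k)"
      using insert.prems by (intro tri n.M.finsum_closed) auto
    finally show ?case using insert by fastforce
  qed
  show ?thesis
    unfolding A_precompact_def
  proof (intro conjI allI impI)
    show "F ` unit_ball A N \<subseteq> carrier N" using Fcl by (auto simp: unit_ball_def)
    show "\<exists>C. \<forall>x\<in>F ` unit_ball A N. hnorm A N x \<le> C" using FC by blast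
  next
    fix \<epsilon> :: real assume "\<epsilon> > 0"
    then obtain T where T: "T \<in> theta_span A N"
      and small: "op_norm A N (\<lambda>z. F z \<ominus>\<^bsub>N\<^esub> T z) < \<epsilon>"
      using F by (auto simp: Banach_compact_def)
    from T obtain s :: nat and c z f where
      T_eq: "T = (\<lambda>v. \<Oplus>\<^bsub>N\<^esub>k\<in>{1..s}. c k \<odot>\<^bsub>N\<^esub> theta N (z k) (f k) v)"
      and zf: "\<forall>k\<in>{1..s}. z k \<in> carrier N \<and> bounded_functional A N (f k)"
      unfolding theta_span_def by blast
    have z: "z k \<in> carrier N" if "k \<in> {1..s}" for k using zf that by blast
    have fcl: "f k v \<in> carrier A" if "k \<in> {1..s}" "v \<in> carrier N" for k v
      using zf that by (auto simp: bounded_functional_def)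
    have "\<exists>D. \<forall>v\<in>carrier N. cnorm A (f k v) \<le> D * hnorm A N v" if "k \<in> {1..s}" for k
      using zf that by (auto simp: bounded_functional_def)
    then obtain D where D: "\<And>k v. \<lbrakk>k \<in> {1..s}; v \<in> carrier N\<rbrakk>
        \<Longrightarrow> cnorm A (f k v) \<le> D k * hnorm A N v"
      by metis
    define a where "a v k = c k \<odot> f k v" for v k
    \<comment> \<open>The summand \<open>1\<close> only serves to make the bound strictly positive.\<close>
    define M where "M = 1 + (\<Sum>k\<in>{1..s}. cmod (c k) * \<bar>D k\<bar>)"
    have acl: "a v k \<in> carrier A" if "k \<in> {1..s}" "v \<in> carrier N" for v k
      using m.smult_closed[of "c k" "f k v"] fcl[OF that]
      by (simp add: a_def complex_ring_def)
    have aM: "cnorm A (a v k) \<le> M" if k: "k \<in> {1..s}" and v: "v \<in> unit_ball A N" for v k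
    proof -
      have v': "v \<in> carrier N" "hnorm A N v \<le> 1" using v by (auto simp: unit_ball_def)
      have "D k * hnorm A N v \<le> \<bar>D k\<bar> * 1"
        by (rule mult_mono) (use v' hnorm_nonneg in auto)
      then have "cnorm A (f k v) \<le> \<bar>D k\<bar>"
        using D[OF k v'(1)] by simp
      then have "cnorm A (a v k) \<le> cmod (c k) * \<bar>D k\<bar>"
        by (simp add: a_def cnorm_smult fcl[OF k v'(1)] mult_left_mono)
      also have "\<dots> \<le> (\<Sum>k\<in>{1..s}. cmod (c k) * \<bar>D k\<bar>)"
        by (rule member_le_sum[OF k]) auto
      finally show ?thesis by (simp add: M_def)
    qed
    have T_a: "T v = (\<Oplus>\<^bsub>N\<^esub>k\<in>{1..s}. z k \<cdot>\<^bsub>N\<^esub> a v k)" if v: "v \<in> carrier N" for v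
      unfolding T_eq
    proof (rule n.M.finsum_cong')
      show "(\<lambda>k. z k \<cdot>\<^bsub>N\<^esub> a v k) \<in> {1..s} \<rightarrow> carrier N"
        using z acl v by (auto intro: act_closed)
    next
      fix k assume "k \<in> {1..s}"
      then show "c k \<odot>\<^bsub>N\<^esub> theta N (z k) (f k) v = z k \<cdot>\<^bsub>N\<^esub> a v k"
        using z fcl v by (simp add: theta_def a_def act_smult_r)
    qed simp
    have Tcl: "T v \<in> carrier N" if "v \<in> carrier N" for v
      unfolding T_a[OF that] using z acl that by (intro n.M.finsum_closed) (auto intro: act_closed)
    define G where "G v = F v \<ominus>\<^bsub>N\<^esub> T v" for v
    have "hnorm A N (G v) \<le> \<bar>C\<bar> + (\<Sum>k\<in>{1..s}. hnorm A N (z k) * M)"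
      if v: "v \<in> unit_ball A N" for v
    proof -
      have v': "v \<in> carrier N" using v by (auto simp: unit_ball_def)
      have "hnorm A N (T v) \<le> (\<Sum>k\<in>{1..s}. hnorm A N (z k \<cdot>\<^bsub>N\<^esub> a v k))"
        unfolding T_a[OF v'] using z acl v' by (intro hsum) (auto intro: act_closed)
      also have "\<dots> \<le> (\<Sum>k\<in>{1..s}. hnorm A N (z k) * M)"
      proof (rule sum_mono)
        fix k assume k: "k \<in> {1..s}"
        have "hnorm A N (z k \<cdot>\<^bsub>N\<^esub> a v k) \<le> hnorm A N (z k) * cnorm A (a v k)"
          by (rule hnorm_act_le[OF z[OF k] acl[OF k v']])
        also have "\<dots> \<le> hnorm A N (z k) * M"
          by (rule mult_left_mono[OF aM[OF k v] hnorm_nonneg[OF z[OF k]]])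
        finally show "hnorm A N (z k \<cdot>\<^bsub>N\<^esub> a v k) \<le> hnorm A N (z k) * M" .
      qed
      finally have "hnorm A N (T v) \<le> (\<Sum>k\<in>{1..s}. hnorm A N (z k) * M)" .
      moreover have "hnorm A N (G v) \<le> hnorm A N (F v) + hnorm A N (T v)"
        using tri[of "F v" "\<ominus>\<^bsub>N\<^esub> T v"] Fcl[OF v'] Tcl[OF v']
        by (simp add: G_def a_minus_def hnorm_uminus)
      ultimately show ?thesis using FC[OF v] by linarith
    qed
    then have bdd: "bdd_above ((\<lambda>v. hnorm A N (G v)) ` unit_ball A N)"
      by (rule bdd_aboveI2)
    have close: "hnorm A N (F v \<ominus>\<^bsub>N\<^esub> (\<Oplus>\<^bsub>N\<^esub>k\<in>{1..s}. z k \<cdot>\<^bsub>N\<^esub> a v k)) < \<epsilon>"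
      if v: "v \<in> unit_ball A N" for v
    proof -
      have "hnorm A N (G v) < \<epsilon>"
        using cSUP_upper[OF v bdd] small by (simp add: op_norm_def G_def)
      moreover have "v \<in> carrier N" using v by (simp add: unit_ball_def)
      ultimately show ?thesis by (simp only: G_def T_a)
    qed
    have "M > 0"
      unfolding M_def by (intro add_pos_nonneg sum_nonneg) auto
    moreover have "\<forall>k\<in>{1..s}. a v k \<in> carrier A \<and> cnorm A (a v k) \<le> M"
      if "v \<in> unit_ball A N" for v
      using that acl aM by (auto simp: unit_ball_def)
    ultimately show "\<exists>M>0. \<exists>(s::nat) z. (\<forall>k\<in>{1..s}. z k \<in> carrier N) \<and>
      (\<forall>x\<in>F ` unit_ball A N. \<exists>a. (\<forall>k\<in>{1..s}. a k \<in> carrier A \<and> cnorm A (a k) \<le> M) \<and>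
        hnorm A N (x \<ominus>\<^bsub>N\<^esub> (\<Oplus>\<^bsub>N\<^esub>k\<in>{1..s}. z k \<cdot>\<^bsub>N\<^esub> a k)) < \<epsilon>)"
      using z close by (intro exI[of _ M] conjI exI[of _ s] exI[of _ z]) blast+
  qed
qed

end

section \<open>The C*-algebra of null sequences\<close>

definition null_sequences :: "(nat \<Rightarrow> complex) set" where
  "null_sequences = {x. x \<longlonglongrightarrow> 0}"

definition sup_norm :: "(nat \<Rightarrow> complex) \<Rightarrow> real" where
  "sup_norm x = (SUP n. cmod (x n))"

definition c0 :: "(nat \<Rightarrow> complex) cstar" where
  "c0 = \<lparr>carrier = null_sequences, mult = (\<lambda>x y n. x n * y n), one = (\<lambda>_. 1),
    zero = (\<lambda>_. 0), add = (\<lambda>x y n. x n + y n), smult = (\<lambda>\<mu> x n. \<mu> * x n),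
    star = (\<lambda>x n. cnj (x n)), cnorm = sup_norm\<rparr>"

lemma c0_simps [simp]:
  "carrier c0 = null_sequences"
  "mult c0 x y = (\<lambda>n. x n * y n)"
  "zero c0 = (\<lambda>_. 0)"
  "add c0 x y = (\<lambda>n. x n + y n)"
  "smult c0 \<mu> x = (\<lambda>n. \<mu> * x n)"
  "star c0 x = (\<lambda>n. cnj (x n))"
  "cnorm c0 = sup_norm"
  by (simp_all add: c0_def)

lemma cmod_le_sup_norm:
  assumes "x \<in> null_sequences"
  shows "cmod (x n) \<le> sup_norm x"
proof -
  have "Bseq x"
    using assms convergent_imp_Bseq[OF convergentI] by (simp add: null_sequences_def)
  then obtain K where "\<And>n. cmod (x n) \<le> K" by (auto simp: Bseq_def)
  then have "bdd_above (range (\<lambda>n. cmod (x n)))" by (rule bdd_aboveI2)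
  then show ?thesis unfolding sup_norm_def by (rule cSUP_upper[OF UNIV_I])
qed

lemma sup_norm_nonneg: "x \<in> null_sequences \<Longrightarrow> 0 \<le> sup_norm x"
  using cmod_le_sup_norm[of x 0] norm_ge_zero[of "x 0"] by linarith

lemma sup_norm_le: "(\<And>n. cmod (x n) \<le> K) \<Longrightarrow> sup_norm x \<le> K"
  unfolding sup_norm_def by (rule cSUP_least) auto

lemma null_sequences_add:
  "\<lbrakk>x \<in> null_sequences; y \<in> null_sequences\<rbrakk> \<Longrightarrow> (\<lambda>n. x n + y n) \<in> null_sequences"
  by (simp add: null_sequences_def tendsto_add_zero)

lemma null_sequences_diff:
  "\<lbrakk>x \<in> null_sequences; y \<in> null_sequences\<rbrakk> \<Longrightarrow> (\<lambda>n. x n - y n) \<in> null_sequences"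
  unfolding null_sequences_def using tendsto_diff[of x 0 sequentially y 0] by simp

lemma null_sequences_mult:
  "\<lbrakk>x \<in> null_sequences; y \<in> null_sequences\<rbrakk> \<Longrightarrow> (\<lambda>n. x n * y n) \<in> null_sequences"
  by (simp add: null_sequences_def tendsto_mult_zero)

lemma null_sequences_smult:
  "x \<in> null_sequences \<Longrightarrow> (\<lambda>n. \<mu> * x n) \<in> null_sequences"
  by (simp add: null_sequences_def tendsto_mult_right_zero)

lemma null_sequences_cnj:
  "x \<in> null_sequences \<Longrightarrow> (\<lambda>n. cnj (x n)) \<in> null_sequences"
  unfolding null_sequences_def using tendsto_cnj[of x 0 sequentially] by simp

lemma null_sequences_zero: "(\<lambda>_. 0) \<in> null_sequences"
  by (simp add: null_sequences_def)

lemmas null_sequences_closed =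
  null_sequences_add null_sequences_diff null_sequences_mult null_sequences_smult
  null_sequences_cnj null_sequences_zero

lemma finite_support_null_sequence:
  assumes "\<And>n. n \<ge> K \<Longrightarrow> x n = 0"
  shows "x \<in> null_sequences"
proof -
  have "\<forall>\<^sub>F n in sequentially. x n = 0"
    using assms eventually_sequentially by blast
  then show ?thesis by (simp add: null_sequences_def tendsto_eventually)
qed

lemma module_c0: "module complex_ring c0"
proof (rule moduleI)
  show "cring complex_ring"
  proof (rule cringI)
    show "abelian_group complex_ring"
    proof (rule abelian_groupI)
      fix x assume "x \<in> carrier complex_ring"
      show "\<exists>y\<in>carrier complex_ring. y \<oplus>\<^bsub>complex_ring\<^esub> x = \<zero>\<^bsub>complex_ring\<^esub>"
        by (rule bexI[of _ "- x"]) (auto simp: complex_ring_def)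
    qed (auto simp: complex_ring_def)
    show "Group.comm_monoid complex_ring"
      by (rule comm_monoidI) (auto simp: complex_ring_def)
  qed (auto simp: complex_ring_def algebra_simps)
  show "abelian_group c0"
  proof (rule abelian_groupI)
    fix x assume "x \<in> carrier c0"
    then show "\<exists>y\<in>carrier c0. y \<oplus>\<^bsub>c0\<^esub> x = \<zero>\<^bsub>c0\<^esub>"
      using null_sequences_smult[of x "-1"] by (auto intro!: bexI[of _ "\<lambda>n. - x n"])
  qed (auto simp: null_sequences_closed algebra_simps)
qed (auto simp: complex_ring_def null_sequences_closed algebra_simps)

lemma minus_c0:
  assumes "x \<in> null_sequences" "y \<in> null_sequences"
  shows "x \<ominus>\<^bsub>c0\<^esub> y = (\<lambda>n. x n - y n)"
proof -
  interpret m: module complex_ring c0 by (rule module_c0)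
  have "\<ominus>\<^bsub>c0\<^esub> y = (\<lambda>n. - y n)"
    by (rule m.M.minus_equality) (use assms null_sequences_smult[of y "-1"] in auto)
  then show ?thesis by (simp add: a_minus_def)
qed

text \<open>
  A Cauchy sequence in the sup norm converges uniformly to its pointwise limit, and a uniform
  limit of null sequences is a null sequence.
\<close>

lemma cauchy_complete_c0: "cauchy_complete c0 sup_norm"
  unfolding cauchy_complete_def
proof (intro allI impI, elim conjE)
  fix \<sigma> :: "nat \<Rightarrow> nat \<Rightarrow> complex"
  assume ran: "range \<sigma> \<subseteq> carrier c0"
    and cau: "\<forall>e>0. \<exists>K. \<forall>m\<ge>K. \<forall>n\<ge>K. sup_norm (\<sigma> m \<ominus>\<^bsub>c0\<^esub> \<sigma> n) < e"
  from ran have \<sigma>: "\<sigma> m \<in> null_sequences" for m by auto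
  have cau': "\<exists>K. \<forall>m\<ge>K. \<forall>n\<ge>K. \<forall>i. cmod (\<sigma> m i - \<sigma> n i) < e" if "e > 0" for e
  proof -
    obtain K where K: "\<forall>m\<ge>K. \<forall>n\<ge>K. sup_norm (\<sigma> m \<ominus>\<^bsub>c0\<^esub> \<sigma> n) < e"
      using cau \<open>e > 0\<close> by blast
    have "cmod (\<sigma> m i - \<sigma> n i) < e" if "m \<ge> K" "n \<ge> K" for m n i
    proof -
      have "cmod (\<sigma> m i - \<sigma> n i) \<le> sup_norm (\<sigma> m \<ominus>\<^bsub>c0\<^esub> \<sigma> n)"
        using cmod_le_sup_norm[OF null_sequences_diff[OF \<sigma>[of m] \<sigma>[of n]], of i]
        by (simp add: minus_c0 \<sigma>)
      also have "\<dots> < e" using K that by blast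
      finally show ?thesis .
    qed
    then show ?thesis by blast
  qed
  have Cauchy: "Cauchy (\<lambda>m. \<sigma> m i)" for i
  proof (rule CauchyI)
    fix e :: real assume "0 < e"
    from cau'[OF this] show "\<exists>M. \<forall>m\<ge>M. \<forall>n\<ge>M. norm (\<sigma> m i - \<sigma> n i) < e" by blast
  qed
  define l where "l i = lim (\<lambda>m. \<sigma> m i)" for i
  have l: "(\<lambda>m. \<sigma> m i) \<longlonglongrightarrow> l i" for i
    unfolding l_def by (rule convergent_LIMSEQ_iff[THEN iffD1, OF Cauchy_convergent[OF Cauchy]])
  have unif: "\<exists>K. \<forall>m\<ge>K. \<forall>i. cmod (\<sigma> m i - l i) \<le> e" if "e > 0" for e
  proof -
    obtain K where K: "\<forall>m\<ge>K. \<forall>n\<ge>K. \<forall>i. cmod (\<sigma> m i - \<sigma> n i) < e"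
      using cau'[OF \<open>e > 0\<close>] by blast
    have "cmod (\<sigma> m i - l i) \<le> e" if "m \<ge> K" for m i
    proof (rule LIMSEQ_le_const2)
      show "(\<lambda>n. cmod (\<sigma> m i - \<sigma> n i)) \<longlonglongrightarrow> cmod (\<sigma> m i - l i)"
        by (intro tendsto_intros l)
      show "\<exists>N. \<forall>n\<ge>N. cmod (\<sigma> m i - \<sigma> n i) \<le> e"
        using K that by (auto intro!: exI[of _ K] less_imp_le)
    qed
    then show ?thesis by blast
  qed
  have lc: "l \<in> null_sequences"
    unfolding null_sequences_def
  proof (intro CollectI LIMSEQ_I)
    fix e :: real assume "e > 0"
    then obtain m where m: "\<forall>i. cmod (\<sigma> m i - l i) \<le> e / 2"
      using unif[of "e / 2"] by auto
    obtain K where K: "\<forall>i\<ge>K. cmod (\<sigma> m i) < e / 2"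
      using \<sigma>[of m] LIMSEQ_D[of "\<sigma> m" 0 "e / 2"] \<open>e > 0\<close>
      by (auto simp: null_sequences_def)
    have "cmod (l i) < e" if "i \<ge> K" for i
      using norm_triangle_ineq4[of "\<sigma> m i" "\<sigma> m i - l i"] m[rule_format, of i] K that
      by fastforce
    then show "\<exists>K. \<forall>i\<ge>K. norm (l i - 0) < e" by auto
  qed
  have "(\<lambda>m. sup_norm (\<lambda>i. \<sigma> m i - l i)) \<longlonglongrightarrow> 0"
  proof (rule LIMSEQ_I)
    fix e :: real assume "e > 0"
    then obtain K where K: "\<forall>m\<ge>K. \<forall>i. cmod (\<sigma> m i - l i) \<le> e / 2"
      using unif[of "e / 2"] by auto
    have "norm (sup_norm (\<lambda>i. \<sigma> m i - l i) - 0) < e" if "m \<ge> K" for m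
      using sup_norm_le[of "\<lambda>i. \<sigma> m i - l i" "e / 2"] K that \<open>e > 0\<close>
        sup_norm_nonneg[OF null_sequences_diff[OF \<sigma> lc], of m]
      by simp
    then show "\<exists>K. \<forall>m\<ge>K. norm (sup_norm (\<lambda>i. \<sigma> m i - l i) - 0) < e" by blast
  qed
  then show "\<exists>l\<in>carrier c0. (\<lambda>n. sup_norm (\<sigma> n \<ominus>\<^bsub>c0\<^esub> l)) \<longlonglongrightarrow> 0"
    using lc by (auto simp: minus_c0 \<sigma>)
qed

lemma sup_norm_smult:
  assumes x: "x \<in> null_sequences"
  shows "sup_norm (\<lambda>n. \<mu> * x n) = cmod \<mu> * sup_norm x"
proof (rule antisym)
  show "sup_norm (\<lambda>n. \<mu> * x n) \<le> cmod \<mu> * sup_norm x"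
    by (rule sup_norm_le) (simp add: norm_mult mult_left_mono cmod_le_sup_norm[OF x])
  show "cmod \<mu> * sup_norm x \<le> sup_norm (\<lambda>n. \<mu> * x n)"
  proof (cases "\<mu> = 0")
    case True
    then show ?thesis using sup_norm_nonneg[OF null_sequences_smult[OF x, of \<mu>]] by simp
  next
    case False
    have "sup_norm x \<le> sup_norm (\<lambda>n. \<mu> * x n) / cmod \<mu>"
      using cmod_le_sup_norm[OF null_sequences_smult[OF x, of \<mu>]] False
      by (intro sup_norm_le) (simp add: norm_mult field_simps)
    with False show ?thesis by (simp add: field_simps)
  qed
qed

lemma sup_norm_cnj_mult:
  assumes x: "x \<in> null_sequences"
  shows "sup_norm (\<lambda>n. cnj (x n) * x n) = (sup_norm x)\<^sup>2"
proof (rule antisym)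
  show "sup_norm (\<lambda>n. cnj (x n) * x n) \<le> (sup_norm x)\<^sup>2"
    using cmod_le_sup_norm[OF x]
    by (intro sup_norm_le) (simp add: norm_mult power2_eq_square mult_mono' )
  let ?s = "sup_norm (\<lambda>n. cnj (x n) * x n)"
  have "(cmod (x n))\<^sup>2 \<le> ?s" for n
    using cmod_le_sup_norm[OF null_sequences_mult[OF null_sequences_cnj[OF x] x], of n]
    by (simp add: norm_mult power2_eq_square)
  then have "sup_norm x \<le> sqrt ?s"
    by (intro sup_norm_le real_le_rsqrt)
  then show "(sup_norm x)\<^sup>2 \<le> ?s"
    using sup_norm_nonneg[OF x] sup_norm_nonneg[OF null_sequences_mult[OF null_sequences_cnj[OF x] x]]
    by (metis power_mono real_sqrt_pow2)
qed

lemma cstar_algebra_c0: "cstar_algebra c0"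
proof (rule cstar_algebra.intro)
  show "module complex_ring c0" by (rule module_c0)
  show "cauchy_complete c0 (cnorm c0)" using cauchy_complete_c0 by simp
next
  fix a assume a: "a \<in> carrier c0"
  show "0 \<le> cnorm c0 a" using a by (simp add: sup_norm_nonneg)
  show "cnorm c0 a = 0 \<longleftrightarrow> a = \<zero>\<^bsub>c0\<^esub>"
  proof
    assume "cnorm c0 a = 0"
    then show "a = \<zero>\<^bsub>c0\<^esub>" using cmod_le_sup_norm[of a] a by (auto simp: fun_eq_iff)
  qed (simp add: sup_norm_def)
  show "cnorm c0 (\<mu> \<odot>\<^bsub>c0\<^esub> a) = cmod \<mu> * cnorm c0 a" for \<mu>
    using a by (simp add: sup_norm_smult)
  show "cnorm c0 (star c0 a \<otimes>\<^bsub>c0\<^esub> a) = (cnorm c0 a)\<^sup>2"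
    using a by (simp add: sup_norm_cnj_mult)
next
  fix a b assume ab: "a \<in> carrier c0" "b \<in> carrier c0"
  note le = cmod_le_sup_norm[of a] cmod_le_sup_norm[of b]
  show "cnorm c0 (a \<oplus>\<^bsub>c0\<^esub> b) \<le> cnorm c0 a + cnorm c0 b"
    using ab le by (auto intro!: sup_norm_le norm_triangle_mono)
  show "cnorm c0 (a \<otimes>\<^bsub>c0\<^esub> b) \<le> cnorm c0 a * cnorm c0 b"
    using ab le by (auto intro!: sup_norm_le simp: norm_mult mult_mono')
qed (auto simp: null_sequences_closed algebra_simps)

section \<open>The identity of the module of null sequences\<close>

lemma finsum_c0_apply:
  assumes "finite S" "\<And>k. k \<in> S \<Longrightarrow> g k \<in> null_sequences"
  shows "(\<Oplus>\<^bsub>self_module c0\<^esub>k\<in>S. g k) n = (\<Sum>k\<in>S. g k n)"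
proof -
  interpret module complex_ring "self_module c0"
    by (rule cstar_algebra.module_self_module[OF cstar_algebra_c0])
  show ?thesis
    using assms by (induction S) (auto simp: finsum_insert)
qed

lemma finsum_c0_closed:
  assumes "\<And>k. k \<in> S \<Longrightarrow> g k \<in> null_sequences"
  shows "(\<Oplus>\<^bsub>self_module c0\<^esub>k\<in>S. g k) \<in> null_sequences"
proof -
  interpret module complex_ring "self_module c0"
    by (rule cstar_algebra.module_self_module[OF cstar_algebra_c0])
  show ?thesis using finsum_closed[of g S] assms by auto
qed

lemma hnorm_diff_c0:
  assumes "x \<in> null_sequences" "y \<in> null_sequences"
  shows "hnorm c0 (self_module c0) (x \<ominus>\<^bsub>self_module c0\<^esub> y) = sup_norm (\<lambda>n. x n - y n)"
  using assms
  by (simp add: cstar_algebra.minus_self_module[OF cstar_algebra_c0] minus_c0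
      cstar_algebra.hnorm_self_module[OF cstar_algebra_c0] null_sequences_diff)

lemma unit_ball_c0:
  "unit_ball c0 (self_module c0) = {x \<in> null_sequences. sup_norm x \<le> 1}"
  by (auto simp: unit_ball_def cstar_algebra.hnorm_self_module[OF cstar_algebra_c0])

text \<open>
  Cut off the tail of \<open>x\<close> where its entries are small, and multiply what is left by \<open>n + 1\<close>:
  the result is finitely supported, hence a null sequence, however large its entries.
\<close>

lemma ideal_dense_c0:
  assumes x: "x \<in> null_sequences" and \<epsilon>: "\<epsilon> > 0"
  shows "\<exists>a\<in>null_sequences. sup_norm (\<lambda>n. x n - a n / of_nat (Suc n)) < \<epsilon>"
proof -
  obtain K where K: "\<forall>n\<ge>K. cmod (x n) < \<epsilon> / 2"
    using x LIMSEQ_D[of x 0 "\<epsilon> / 2"] \<epsilon> by (auto simp: null_sequences_def)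
  define a where "a n = (if n < K then of_nat (Suc n) * x n else 0)" for n
  have "sup_norm (\<lambda>n. x n - a n / of_nat (Suc n)) \<le> \<epsilon> / 2"
    using K \<epsilon> by (intro sup_norm_le) (auto simp: a_def simp del: of_nat_Suc intro: less_imp_le)
  moreover have "a \<in> null_sequences"
    by (rule finite_support_null_sequence[of K]) (simp add: a_def)
  ultimately show ?thesis using \<epsilon> by force
qed

text \<open>
  With coefficients of norm at most \<open>M\<close>, every combination of fixed null sequences
  \<open>z\<^sub>1, \<dots>, z\<^sub>s\<close> is small at a late enough index \<open>n\<close>, uniformly in the coefficients. The
  sequence \<open>e\<close> that is \<open>1\<close> at \<open>n\<close> and \<open>0\<close> elsewhere therefore stays at distance more than \<open>1 / 2\<close>.
\<close>

lemma not_A_precompact_unit_ball_c0: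
  "\<not> A_precompact c0 (self_module c0) (unit_ball c0 (self_module c0))"
proof
  assume "A_precompact c0 (self_module c0) (unit_ball c0 (self_module c0))"
  then have "\<exists>M>0. \<exists>s z. (\<forall>k\<in>{1..s::nat}. z k \<in> null_sequences) \<and>
      (\<forall>x\<in>unit_ball c0 (self_module c0).
        \<exists>a. (\<forall>k\<in>{1..s}. a k \<in> null_sequences \<and> sup_norm (a k) \<le> M) \<and>
          hnorm c0 (self_module c0)
            (x \<ominus>\<^bsub>self_module c0\<^esub> (\<Oplus>\<^bsub>self_module c0\<^esub>k\<in>{1..s}. (\<lambda>n. z k n * a k n))) < 1 / 2)"
    unfolding A_precompact_def self_module_simps c0_simps
    by (elim conjE allE[of _ "1 / 2"]) simp
  then obtain M s z where z: "\<forall>k\<in>{1..s::nat}. z k \<in> null_sequences"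
    and approx: "\<forall>x\<in>unit_ball c0 (self_module c0).
      \<exists>a. (\<forall>k\<in>{1..s}. a k \<in> null_sequences \<and> sup_norm (a k) \<le> M) \<and>
        hnorm c0 (self_module c0)
          (x \<ominus>\<^bsub>self_module c0\<^esub> (\<Oplus>\<^bsub>self_module c0\<^esub>k\<in>{1..s}. (\<lambda>n. z k n * a k n))) < 1 / 2"
    by blast
  have "(\<lambda>n. \<Sum>k\<in>{1..s}. cmod (z k n) * M) \<longlonglongrightarrow> (\<Sum>k\<in>{1..s}. 0 * M)"
    using z by (intro tendsto_intros) (auto simp: null_sequences_def tendsto_norm_zero)
  then have "\<forall>\<^sub>F n in sequentially. (\<Sum>k\<in>{1..s}. cmod (z k n) * M) < 1 / 2"
    by (rule order_tendstoD) simp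
  then obtain n where n: "(\<Sum>k\<in>{1..s}. cmod (z k n) * M) < 1 / 2"
    using eventually_happens by fastforce
  define e :: "nat \<Rightarrow> complex" where "e i = (if i = n then 1 else 0)" for i
  have e: "e \<in> null_sequences"
    by (rule finite_support_null_sequence[of "Suc n"]) (simp add: e_def)
  have "sup_norm e \<le> 1" by (rule sup_norm_le) (simp add: e_def)
  with e have "e \<in> unit_ball c0 (self_module c0)" by (simp add: unit_ball_c0)
  then obtain a where a: "\<forall>k\<in>{1..s}. a k \<in> null_sequences \<and> sup_norm (a k) \<le> M"
    and close: "hnorm c0 (self_module c0)
      (e \<ominus>\<^bsub>self_module c0\<^esub> (\<Oplus>\<^bsub>self_module c0\<^esub>k\<in>{1..s}. (\<lambda>n. z k n * a k n))) < 1 / 2"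
    using approx by blast
  define y where "y = (\<Oplus>\<^bsub>self_module c0\<^esub>k\<in>{1..s}. (\<lambda>n. z k n * a k n))"
  have za: "(\<lambda>n. z k n * a k n) \<in> null_sequences" if "k \<in> {1..s}" for k
    using z a that null_sequences_mult by blast
  have y: "y \<in> null_sequences" unfolding y_def by (rule finsum_c0_closed[OF za])
  have "cmod (y n) = cmod (\<Sum>k\<in>{1..s}. z k n * a k n)"
    unfolding y_def by (subst finsum_c0_apply[OF _ za]) auto
  also have "\<dots> \<le> (\<Sum>k\<in>{1..s}. cmod (z k n) * M)"
  proof (rule sum_norm_le)
    fix k assume "k \<in> {1..s}"
    then have "cmod (a k n) \<le> M" using a cmod_le_sup_norm[of "a k" n] by force
    then show "cmod (z k n * a k n) \<le> cmod (z k n) * M"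
      by (simp add: norm_mult mult_left_mono)
  qed
  finally have "cmod (y n) < 1 / 2" using n by simp
  moreover have "cmod (e n - y n) < 1 / 2"
    using cmod_le_sup_norm[OF null_sequences_diff[OF e y], of n]
      close[folded y_def, unfolded hnorm_diff_c0[OF e y]]
    by (rule order_le_less_trans)
  ultimately show False
    using norm_triangle_ineq[of "e n - y n" "y n"] by (simp add: e_def)
qed

theorem theorem5p3:
  shows "\<exists>(A :: (nat \<Rightarrow> complex) cstar) (N :: (nat \<Rightarrow> complex, nat \<Rightarrow> complex) hmodule) F.
    cstar_algebra A \<and> hilbert_module A N \<and> bounded_operator A N F \<and>
    (\<forall>\<epsilon>>0. \<exists>(s::nat) z. (\<forall>k\<in>{1..s}. z k \<in> carrier N) \<and>
      (\<forall>x\<in>F ` unit_ball A N. \<exists>a. (\<forall>k\<in>{1..s}. a k \<in> carrier A) \<and>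
        hnorm A N (x \<ominus>\<^bsub>N\<^esub> (\<Oplus>\<^bsub>N\<^esub>k\<in>{1..s}. z k \<cdot>\<^bsub>N\<^esub> a k)) < \<epsilon>)) \<and>
    \<not> A_precompact A N (F ` unit_ball A N) \<and>
    \<not> Banach_compact A N F"
proof -
  let ?N = "self_module c0" and ?F = "\<lambda>x :: nat \<Rightarrow> complex. x"
  interpret cstar_algebra c0 by (rule cstar_algebra_c0)
  interpret hilbert_module c0 ?N by (rule hilbert_module_self_module)
  define z :: "nat \<Rightarrow> nat \<Rightarrow> complex" where "z k n = 1 / of_nat (Suc n)" for k n
  have z: "z k \<in> null_sequences" for k
    using LIMSEQ_Suc[OF lim_1_over_n[where 'a = complex]]
    unfolding z_def null_sequences_def by simp
  have op: "bounded_operator c0 ?N ?F"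
    unfolding bounded_operator_def by (auto intro: exI[of _ 1])
  have unbounded_approx: "\<exists>a. (\<forall>k\<in>{1..1}. a k \<in> carrier c0) \<and>
      hnorm c0 ?N (x \<ominus>\<^bsub>?N\<^esub> (\<Oplus>\<^bsub>?N\<^esub>k\<in>{1..1::nat}. z k \<cdot>\<^bsub>?N\<^esub> a k)) < \<epsilon>"
    if "\<epsilon> > 0" "x \<in> ?F ` unit_ball c0 ?N" for \<epsilon> x
  proof -
    have x: "x \<in> null_sequences" using that by (simp add: unit_ball_c0)
    obtain a where a: "a \<in> null_sequences"
      and close: "sup_norm (\<lambda>n. x n - a n / of_nat (Suc n)) < \<epsilon>"
      using ideal_dense_c0[OF x \<open>\<epsilon> > 0\<close>] by blast
    have za: "(\<lambda>n. z k n * a n) \<in> null_sequences" for k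
      by (rule null_sequences_mult[OF z a])
    define y where "y = (\<Oplus>\<^bsub>?N\<^esub>k\<in>{1..1::nat}. (\<lambda>n. z k n * a n))"
    have "y \<in> null_sequences" unfolding y_def by (rule finsum_c0_closed[OF za])
    moreover have "y = (\<lambda>n. a n / of_nat (Suc n))"
      unfolding y_def by (rule ext, subst finsum_c0_apply) (simp_all add: za, simp add: z_def)
    ultimately have "hnorm c0 ?N (x \<ominus>\<^bsub>?N\<^esub> y) < \<epsilon>"
      using close x by (simp add: hnorm_diff_c0)
    then show ?thesis using a by (intro exI[of _ "\<lambda>_. a"]) (simp add: y_def)
  qed
  have not_precompact: "\<not> A_precompact c0 ?N (?F ` unit_ball c0 ?N)"
    using not_A_precompact_unit_ball_c0 by simp
  have "\<not> Banach_compact c0 ?N ?F"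
  proof
    assume "Banach_compact c0 ?N ?F"
    moreover have "hnorm c0 ?N (x \<oplus>\<^bsub>?N\<^esub> y) \<le> hnorm c0 ?N x + hnorm c0 ?N y"
      if "x \<in> carrier ?N" "y \<in> carrier ?N" for x y
      using that cnorm_triangle[of x y] null_sequences_add[of x y]
      by (simp add: hnorm_self_module)
    ultimately show False
      using Banach_compact_imp_A_precompact not_precompact by blast
  qed
  with op unbounded_approx not_precompact z show ?thesis
    by (intro exI[of _ c0] exI[of _ ?N] exI[of _ ?F] conjI allI impI
        exI[of _ "1::nat"] exI[of _ z] cstar_algebra_axioms hilbert_module_axioms) auto
qed

end
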